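(* Let $G=(V,E)$ be a finite graph with orientation $\varepsilon$, $A,B$ abelian groups, $\Omega=T(G,\varepsilon;A)\times F(G,\varepsilon;B)$, $R$ a commutative ring, $u,v\in R$, and $\nu$ an $R$-valued valuation on the Boolean algebra of subsets of $\Omega$ generated by products of a coset of a subgroup of $T(G,\varepsilon;A)$ with a coset of a subgroup of $F(G,\varepsilon;B)$. Then \[ \iint\limits_{\ker f\subseteq\operatorname{supp}g}u^{|\ker f|}v^{|\operatorname{supp}g|}\,d\nu(f,g)=\sum_{Z,W\subseteq E}(-1)^{|Z|}h_{Z,W}(u,v)\,\nu(\Omega_{Z,E-W}), \] where $h_{Z,W}(u,v)=v^{|W|}(1-u)^{|Z\cap W|}(1-v)^{|E-(Z\cup W)|}(uv-v+1)^{|Z-W|}$. In particular, \[ \iint\limits_{\ker f\subseteq\operatorname{supp}g}d\nu(f,g)=\sum_{Z\subseteq E}(-1)^{|Z|}\nu(\Omega_{Z,Z}). \]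
   Context: $T(G,\varepsilon;A)$ and $F(G,\varepsilon;B)$ are the groups of $A$-valued tensions (zero signed sum around every circuit traversal) and $B$-valued flows (net flow zero at every vertex). $\operatorname{supp}f=\{e:f(e)\ne0\}$, $\ker f=E-\operatorname{supp}f$. $\Omega_{X,Y}=\{(f,g)\in\Omega:f|_X=0,\ g|_Y=0\}$, $\Omega^0_{X,Y}=\{(f,g)\in\Omega:\ker f=X,\ \ker g=Y\}$. A valuation satisfies $\nu(\emptyset)=0$, $\nu(S\cup S')+\nu(S\cap S')=\nu(S)+\nu(S')$. For a condition $P$ on $(\ker f,\ker g)$ and weight depending only on $(\ker f,\ker g)=(X,Y)$, $\iint_Pw\,d\nu:=\sum_{(X,Y)\text{ satisfying }P}w_{X,Y}\nu(\Omega^0_{X,Y})$; convention $0^0=1$. *)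

theory Defs
  imports
    "Graph_Theory.Arc_Walk"
    "HOL-Library.Function_Algebras"
    "HOL-Library.Set_Algebras"
    "HOL-Analysis.Sigma_Algebra"
begin

text \<open>
  A finite graph with an orientation, loops and multiple edges allowed, is a \<^locale>\<open>fin_digraph\<close>:
  the edges are the arcs, each directed from its tail to its head. Functions on the edge set
  are represented by total functions that vanish outside the edge set.
\<close>

definition traversal_digraph :: "('v, 'e) pre_digraph \<Rightarrow> ('v, 'e \<times> bool) pre_digraph" where
  "traversal_digraph G =
    \<lparr>verts = verts G,
     arcs = arcs G \<times> UNIV,
     tail = (\<lambda>(e, along). if along then tail G e else head G e),
     head = (\<lambda>(e, along). if along then head G e else tail G e)\<rparr>"

text \<open>
  Circuits belong to the underlying undirected graph, so their edges may be traversed along or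
  against the orientation. Distinctness of the edges excludes the closed walk that runs through
  a single edge back and forth. A loop is a circuit of length one.
\<close>

definition circuit_traversal :: "('v, 'e) pre_digraph \<Rightarrow> ('e \<times> bool) list \<Rightarrow> bool" where
  "circuit_traversal G p \<longleftrightarrow>
    pre_digraph.cycle (traversal_digraph G) p \<and> distinct (map fst p)"

definition tensions :: "('v, 'e) pre_digraph \<Rightarrow> ('e \<Rightarrow> 'a::ab_group_add) set" where
  "tensions G = {f. (\<forall>e. e \<notin> arcs G \<longrightarrow> f e = 0) \<and>
     (\<forall>p. circuit_traversal G p \<longrightarrow> (\<Sum>(e, along)\<leftarrow>p. if along then f e else - f e) = 0)}"

definition flows :: "('v, 'e) pre_digraph \<Rightarrow> ('e \<Rightarrow> 'b::ab_group_add) set" where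
  "flows G = {g. (\<forall>e. e \<notin> arcs G \<longrightarrow> g e = 0) \<and>
     (\<forall>v\<in>verts G. (\<Sum>e\<in>out_arcs G v. g e) - (\<Sum>e\<in>in_arcs G v. g e) = 0)}"

definition fsupp :: "('v, 'e) pre_digraph \<Rightarrow> ('e \<Rightarrow> 'a::zero) \<Rightarrow> 'e set" where
  "fsupp G f = {e \<in> arcs G. f e \<noteq> 0}"

definition fker :: "('v, 'e) pre_digraph \<Rightarrow> ('e \<Rightarrow> 'a::zero) \<Rightarrow> 'e set" where
  "fker G f = arcs G - fsupp G f"

definition Omega :: "('v, 'e) pre_digraph \<Rightarrow>
    (('e \<Rightarrow> 'a::ab_group_add) \<times> ('e \<Rightarrow> 'b::ab_group_add)) set" where
  "Omega G = tensions G \<times> flows G"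

definition Omega_on :: "('v, 'e) pre_digraph \<Rightarrow> 'e set \<Rightarrow> 'e set \<Rightarrow>
    (('e \<Rightarrow> 'a::ab_group_add) \<times> ('e \<Rightarrow> 'b::ab_group_add)) set" where
  "Omega_on G X Y = {(f, g) \<in> Omega G. (\<forall>e\<in>X. f e = 0) \<and> (\<forall>e\<in>Y. g e = 0)}"

definition Omega0 :: "('v, 'e) pre_digraph \<Rightarrow> 'e set \<Rightarrow> 'e set \<Rightarrow>
    (('e \<Rightarrow> 'a::ab_group_add) \<times> ('e \<Rightarrow> 'b::ab_group_add)) set" where
  "Omega0 G X Y = {(f, g) \<in> Omega G. fker G f = X \<and> fker G g = Y}"

definition add_subgroup :: "'c::ab_group_add set \<Rightarrow> 'c set \<Rightarrow> bool" where
  "add_subgroup H K \<longleftrightarrow> H \<subseteq> K \<and> 0 \<in> H \<and> (\<forall>x\<in>H. \<forall>y\<in>H. x + y \<in> H) \<and> (\<forall>x\<in>H. - x \<in> H)"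

definition subgroup_cosets :: "'c::ab_group_add set \<Rightarrow> 'c set set" where
  "subgroup_cosets K = {x +o H | x H. x \<in> K \<and> add_subgroup H K}"

definition coset_algebra :: "('v, 'e) pre_digraph \<Rightarrow>
    (('e \<Rightarrow> 'a::ab_group_add) \<times> ('e \<Rightarrow> 'b::ab_group_add)) set set" where
  "coset_algebra G =
    algebra (Omega G) hull
      {C \<times> D | C D. C \<in> subgroup_cosets (tensions G) \<and> D \<in> subgroup_cosets (flows G)}"

definition valuation_on :: "'c set set \<Rightarrow> ('c set \<Rightarrow> 'r::comm_ring_1) \<Rightarrow> bool" where
  "valuation_on \<B> \<nu> \<longleftrightarrow> \<nu> {} = 0 \<and> (\<forall>S\<in>\<B>. \<forall>S'\<in>\<B>. \<nu> (S \<union> S') + \<nu> (S \<inter> S') = \<nu> S + \<nu> S')"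

text \<open>
  The integral over all \<open>(f, g)\<close> whose kernels \<open>(X, Y)\<close> satisfy \<open>P\<close>, of an integrand
  whose value is \<open>w X Y\<close>.
\<close>

definition kernel_integral :: "('v, 'e) pre_digraph \<Rightarrow>
    ((('e \<Rightarrow> 'a::ab_group_add) \<times> ('e \<Rightarrow> 'b::ab_group_add)) set \<Rightarrow> 'r::comm_ring_1) \<Rightarrow>
    ('e set \<Rightarrow> 'e set \<Rightarrow> bool) \<Rightarrow> ('e set \<Rightarrow> 'e set \<Rightarrow> 'r) \<Rightarrow> 'r" where
  "kernel_integral G \<nu> P w =
    (\<Sum>(X, Y) \<in> {(X, Y). X \<subseteq> arcs G \<and> Y \<subseteq> arcs G \<and> P X Y}. w X Y * \<nu> (Omega0 G X Y))"

definition h_weight :: "'e set \<Rightarrow> 'r::comm_ring_1 \<Rightarrow> 'r \<Rightarrow> 'e set \<Rightarrow> 'e set \<Rightarrow> 'r" where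
  "h_weight E u v Z W =
    v ^ card W * (1 - u) ^ card (Z \<inter> W) * (1 - v) ^ card (E - (Z \<union> W)) *
    (u * v - v + 1) ^ card (Z - W)"

end

theory Submission
  imports Defs
begin

text \<open>
  Split \<open>\<Omega>\<^bsub>Z,E-W\<^esub>\<close> into the strata \<open>\<Omega>\<^sup>0\<^bsub>X,Y\<^esub>\<close> with \<open>Z \<subseteq> X\<close> and \<open>E - W \<subseteq> Y\<close> and exchange
  the sums. The coefficient of \<open>\<nu>(\<Omega>\<^sup>0\<^bsub>X,Y\<^esub>)\<close> is then a sum over \<open>(Z, W)\<close> of a product over the edges,
  hence a product of edgewise sums. An edge \<open>e\<close> contributes \<open>uv\<close>, \<open>0\<close>, \<open>v\<close> or \<open>1\<close> when
  \<open>e \<in> X - Y\<close>, \<open>e \<in> X \<inter> Y\<close>, \<open>e \<notin> X \<union> Y\<close> or \<open>e \<in> Y - X\<close> respectively.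
\<close>

section \<open>Sums over subsets of edgewise products\<close>

text \<open>Expanding the product of binomials means choosing one summand per edge, and
  \<open>Z\<close> records the edges with choice \<open>True\<close>. In the induction the subsets
  of \<open>insert x E\<close> split into those avoiding \<open>x\<close> and those containing
  it.\<close>

lemma sum_Pow_prod:
  fixes a :: "'e \<Rightarrow> bool \<Rightarrow> 'r::comm_ring_1"
  assumes "finite E"
  shows "(\<Sum>Z\<in>Pow E. \<Prod>e\<in>E. a e (e \<in> Z)) = (\<Prod>e\<in>E. a e True + a e False)"
  using assms
proof (induction E)
  case empty
  then show ?case by simp
next
  case (insert x E)
  have inj: "inj_on (insert x) (Pow E)"
    using insert.hyps by (auto simp: inj_on_def)
  have disj: "Pow E \<inter> insert x ` Pow E = {}"
    using insert.hyps by auto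
  have out: "(\<Prod>e\<in>insert x E. a e (e \<in> Z)) = a x False * (\<Prod>e\<in>E. a e (e \<in> Z))"
    if "Z \<in> Pow E" for Z
  proof -
    have "x \<notin> Z" using that insert.hyps by auto
    then show ?thesis using insert.hyps by simp
  qed
  have into: "(\<Prod>e\<in>insert x E. a e (e \<in> insert x Z)) = a x True * (\<Prod>e\<in>E. a e (e \<in> Z))"
    for Z
  proof -
    have "(\<Prod>e\<in>E. a e (e \<in> insert x Z)) = (\<Prod>e\<in>E. a e (e \<in> Z))"
      using insert.hyps by (intro prod.cong arg_cong[where f = "a _"]) auto
    then show ?thesis using insert.hyps by simp
  qed
  have "(\<Sum>Z\<in>Pow (insert x E). \<Prod>e\<in>insert x E. a e (e \<in> Z))
      = (\<Sum>Z\<in>Pow E. \<Prod>e\<in>insert x E. a e (e \<in> Z))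
        + (\<Sum>Z\<in>Pow E. \<Prod>e\<in>insert x E. a e (e \<in> insert x Z))"
    using insert.hyps disj
    by (simp only: Pow_insert sum.union_disjoint finite_Pow_iff finite_imageI
        sum.reindex[OF inj] o_def)
  also have "\<dots> = (\<Sum>Z\<in>Pow E. a x False * (\<Prod>e\<in>E. a e (e \<in> Z)))
        + (\<Sum>Z\<in>Pow E. a x True * (\<Prod>e\<in>E. a e (e \<in> Z)))"
    by (intro arg_cong2[where f = "(+)"] sum.cong refl) (simp_all only: out into)
  also have "\<dots> = (a x True + a x False) * (\<Sum>Z\<in>Pow E. \<Prod>e\<in>E. a e (e \<in> Z))"
    by (simp add: sum_distrib_left algebra_simps sum.distrib)
  finally show ?case
    using insert by simp
qed

text \<open>Summing over \<open>W\<close> with \<open>Z\<close> fixed leaves edgewise factors that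
  depend only on membership in \<open>Z\<close>, so the single-subset expansion applies a second
  time.\<close>

lemma sum_Pow_Pow_prod:
  fixes a :: "'e \<Rightarrow> bool \<Rightarrow> bool \<Rightarrow> 'r::comm_ring_1"
  assumes "finite E"
  shows "(\<Sum>Z\<in>Pow E. \<Sum>W\<in>Pow E. \<Prod>e\<in>E. a e (e \<in> Z) (e \<in> W))
    = (\<Prod>e\<in>E. a e True True + a e True False + a e False True + a e False False)"
proof -
  have "(\<Sum>W\<in>Pow E. \<Prod>e\<in>E. a e (e \<in> Z) (e \<in> W))
      = (\<Prod>e\<in>E. a e (e \<in> Z) True + a e (e \<in> Z) False)" for Z
    by (rule sum_Pow_prod[OF assms, of "\<lambda>e. a e (e \<in> Z)"])
  then show ?thesis
    using sum_Pow_prod[OF assms, of "\<lambda>e z. a e z True + a e z False"]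
    by (simp add: add.assoc)
qed

text \<open>Spreading a power over all of \<open>E\<close>, with factor 1 off \<open>A\<close>, lets
  powers with different exponent sets be merged edge by edge.\<close>

lemma power_card_eq_prod:
  fixes x :: "'r::comm_ring_1"
  assumes "finite E" and "A \<subseteq> E"
  shows "x ^ card A = (\<Prod>e\<in>E. if e \<in> A then x else 1)"
proof -
  have "E \<inter> {e. e \<in> A} = A" using assms by auto
  then show ?thesis using assms by (simp add: prod.If_cases)
qed

text \<open>Each edge lies in exactly one of \<open>Z \<inter> W\<close>, \<open>Z - W\<close>,
  \<open>W - Z\<close> and \<open>E - (Z \<union> W)\<close>. The sign gives a factor -1 per edge of
  \<open>Z\<close>, which turns \<open>v * (1 - u)\<close> into \<open>v * (u - 1)\<close> and
  \<open>u * v - v + 1\<close> into \<open>v - u * v - 1\<close>.\<close>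

lemma h_weight_eq_prod:
  fixes u v :: "'r::comm_ring_1"
  assumes "finite E" and "Z \<subseteq> E" and "W \<subseteq> E"
  shows "(- 1) ^ card Z * h_weight E u v Z W
    = (\<Prod>e\<in>E. if e \<in> Z then (if e \<in> W then v * (u - 1) else v - u * v - 1)
               else (if e \<in> W then v else 1 - v))"
proof -
  have sub: "Z \<inter> W \<subseteq> E" "E - (Z \<union> W) \<subseteq> E" "Z - W \<subseteq> E"
    using assms by auto
  show ?thesis
    unfolding h_weight_def power_card_eq_prod[OF assms(1,2)] power_card_eq_prod[OF assms(1,3)]
      power_card_eq_prod[OF assms(1) sub(1)] power_card_eq_prod[OF assms(1) sub(2)]
      power_card_eq_prod[OF assms(1) sub(3)] prod.distrib[symmetric]
    by (intro prod.cong refl) (auto simp: algebra_simps)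
qed

lemma prod_indicator:
  assumes "finite E"
  shows "(\<Prod>e\<in>E. if Q e then 1 else (0::'r::comm_ring_1)) = (if \<forall>e\<in>E. Q e then 1 else 0)"
  using assms by (induction E) auto

lemma sum_h_weight:
  fixes u v :: "'r::comm_ring_1"
  assumes "finite E" and "X \<subseteq> E" and "Y \<subseteq> E"
  shows "(\<Sum>Z\<in>Pow E. \<Sum>W\<in>Pow E. (- 1) ^ card Z * h_weight E u v Z W *
            (if Z \<subseteq> X \<and> E - W \<subseteq> Y then 1 else 0))
    = (if X \<subseteq> E - Y then u ^ card X * v ^ card (E - Y) else 0)"
proof -
  \<comment> \<open>The last factor is the edgewise form of
    \<open>Z \<subseteq> X \<and> E - W \<subseteq> Y\<close>: it removes the choices forbidden at
    \<open>e\<close>.\<close>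
  define a where "a e z w = (if z then (if w then v * (u - 1) else v - u * v - 1)
      else (if w then v else 1 - v)) * (if (z \<longrightarrow> e \<in> X) \<and> (\<not> w \<longrightarrow> e \<in> Y) then 1 else 0)"
    for e z w
  have "(- 1) ^ card Z * h_weight E u v Z W * (if Z \<subseteq> X \<and> E - W \<subseteq> Y then 1 else 0)
      = (\<Prod>e\<in>E. a e (e \<in> Z) (e \<in> W))" if "Z \<subseteq> E" "W \<subseteq> E" for Z W
  proof -
    have "(if Z \<subseteq> X \<and> E - W \<subseteq> Y then 1 else 0)
        = (\<Prod>e\<in>E. if (e \<in> Z \<longrightarrow> e \<in> X) \<and> (e \<notin> W \<longrightarrow> e \<in> Y) then 1 else (0::'r))"
      unfolding prod_indicator[OF assms(1)] using that by (intro if_cong) auto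
    then show ?thesis
      unfolding a_def prod.distrib h_weight_eq_prod[OF assms(1) that] by simp
  qed
  then have "(\<Sum>Z\<in>Pow E. \<Sum>W\<in>Pow E. (- 1) ^ card Z * h_weight E u v Z W *
            (if Z \<subseteq> X \<and> E - W \<subseteq> Y then 1 else 0))
      = (\<Sum>Z\<in>Pow E. \<Sum>W\<in>Pow E. \<Prod>e\<in>E. a e (e \<in> Z) (e \<in> W))"
    by (intro sum.cong refl) auto
  also have "\<dots> = (\<Prod>e\<in>E. a e True True + a e True False + a e False True + a e False False)"
    by (rule sum_Pow_Pow_prod[OF assms(1)])
  \<comment> \<open>In \<open>X - Y\<close> the choices with \<open>w\<close> true remain and give
    \<open>v * (u - 1) + v\<close>; in \<open>Y - X\<close> those with \<open>z\<close> false give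
    \<open>v + (1 - v)\<close>; outside both only \<open>v\<close> survives. In
    \<open>X \<inter> Y\<close> all four remain and cancel, which is what enforces
    \<open>X \<subseteq> E - Y\<close>.\<close>
  also have "\<dots> = (\<Prod>e\<in>E. (if e \<in> X then u else 1) * (if e \<in> E - Y then v else 1)
      * (if e \<in> X \<longrightarrow> e \<notin> Y then 1 else 0))"
    by (intro prod.cong refl) (auto simp: a_def algebra_simps)
  also have "\<dots> = u ^ card X * v ^ card (E - Y) * (if \<forall>e\<in>E. e \<in> X \<longrightarrow> e \<notin> Y then 1 else 0)"
    by (simp only: prod.distrib prod_indicator[OF assms(1)] power_card_eq_prod[OF assms(1,2)]
        power_card_eq_prod[OF assms(1) Diff_subset])
  also have "\<dots> = (if X \<subseteq> E - Y then u ^ card X * v ^ card (E - Y) else 0)"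
    using assms by auto
  finally show ?thesis .
qed

text \<open>Here \<open>1 - u\<close> and \<open>1 - v\<close> vanish while the other bases equal 1.
  By the convention that 0 to the power 0 is 1, the weight survives exactly when both exponents of 0
  vanish.\<close>

lemma h_weight_one_one:
  assumes "finite E" and "Z \<subseteq> E" and "W \<subseteq> E"
  shows "h_weight E 1 (1::'r::comm_ring_1) Z W = (if W = E - Z then 1 else 0)"
proof -
  \<comment> \<open>Since \<open>card\<close> is also 0 on infinite sets, finiteness is what turns a
    zero exponent into emptiness.\<close>
  have fin: "finite (Z \<inter> W)" "finite (E - (Z \<union> W))"
    using assms by (auto intro: finite_subset)
  have "W = E - Z \<longleftrightarrow> Z \<inter> W = {} \<and> E - (Z \<union> W) = {}"
    using assms by auto
  then show ?thesis
    using fin by (auto simp: h_weight_def power_0_left)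
qed

section \<open>The algebra generated by cosets\<close>

text \<open>The hull is the intersection of all algebras containing the generators, and closure
  properties pass to intersections. Containment in \<open>Pow \<Omega>\<close> holds because
  \<open>Pow \<Omega>\<close> is itself one of the intersected algebras.\<close>

lemma algebra_hull:
  assumes "\<G> \<subseteq> Pow \<Omega>"
  shows "algebra \<Omega> (algebra \<Omega> hull \<G>)"
proof -
  have le: "algebra \<Omega> hull \<G> \<subseteq> Pow \<Omega>"
    unfolding hull_def using assms algebra_Pow[of \<Omega>] by auto
  then show ?thesis
    unfolding algebra_iff_Un by (auto simp: hull_def algebra_iff_Un)
qed

text \<open>For a fixed edge list the signed sum is additive in \<open>f\<close>, so the circuit
  conditions and the vanishing on \<open>X\<close> are preserved by sums and negatives.\<close>

lemma add_subgroup_tensions: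
  "add_subgroup {f \<in> tensions G. \<forall>e\<in>X. f e = (0::'a::ab_group_add)} (tensions G)"
proof -
  let ?s = "\<lambda>f p. \<Sum>(e, along)\<leftarrow>p. if along then f e else - f e :: 'a"
  have add: "?s (f + g) p = ?s f p + ?s g p" for f g p
    by (induction p) (auto simp: algebra_simps)
  have neg: "?s (- f) p = - ?s f p" for f p
    by (induction p) (auto simp: algebra_simps)
  have zero: "?s 0 p = 0" for p
    by (induction p) auto
  show ?thesis
    unfolding add_subgroup_def tensions_def by (auto simp: add neg zero)
qed

lemma add_subgroup_flows:
  "add_subgroup {g \<in> flows G. \<forall>e\<in>Y. g e = (0::'b::ab_group_add)} (flows G)"
  unfolding add_subgroup_def flows_def
  by (auto simp: sum.distrib sum_negf algebra_simps)

lemma subgroup_in_subgroup_cosets: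
  assumes "add_subgroup H K"
  shows "H \<in> subgroup_cosets K"
proof -
  have "H = 0 +o H" and "0 \<in> K"
    using assms by (auto simp: add_subgroup_def)
  then show ?thesis
    unfolding subgroup_cosets_def using assms by blast
qed

text \<open>This places the generating products inside \<open>Omega G\<close>, as the hull argument
  requires.\<close>

lemma subgroup_coset_subset:
  assumes "add_subgroup K K" and "C \<in> subgroup_cosets K"
  shows "C \<subseteq> K"
  using assms by (auto simp: subgroup_cosets_def add_subgroup_def elt_set_plus_def)

lemma algebra_coset_algebra:
  "algebra (Omega G :: (('e \<Rightarrow> 'a::ab_group_add) \<times> ('e \<Rightarrow> 'b::ab_group_add)) set) (coset_algebra G)"
proof -
  \<comment> \<open>Vanishing on the empty set is no condition, so the instances with
    \<open>{}\<close> are the full groups.\<close>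
  have "add_subgroup (tensions G :: ('e \<Rightarrow> 'a) set) (tensions G)"
    and "add_subgroup (flows G :: ('e \<Rightarrow> 'b) set) (flows G)"
    using add_subgroup_tensions[of G "{}"] add_subgroup_flows[of G "{}"] by auto
  note sub = this[THEN subgroup_coset_subset]
  show ?thesis
    unfolding coset_algebra_def Omega_def
    by (intro algebra_hull) (use sub in blast)
qed

text \<open>The vanishing conditions on \<open>f\<close> and \<open>g\<close> are independent, so
  the set is a product of two subgroups, each a coset of itself, and hence a generator.\<close>

lemma Omega_on_in_coset_algebra: "Omega_on G X Y \<in> coset_algebra G"
proof -
  have "Omega_on G X Y
      = {f \<in> tensions G. \<forall>e\<in>X. f e = 0} \<times> {g \<in> flows G. \<forall>e\<in>Y. g e = 0}"
    by (auto simp: Omega_on_def Omega_def)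
  also have "\<dots> \<in> coset_algebra G"
    unfolding coset_algebra_def
    by (rule hull_inc, rule CollectI, rule exI, rule exI, rule conjI, rule refl)
      (intro conjI subgroup_in_subgroup_cosets add_subgroup_tensions add_subgroup_flows)
  finally show ?thesis .
qed

text \<open>A kernel is exactly \<open>X\<close> if it contains \<open>X\<close> and no further
  edge. The stratum therefore arises by removing the finitely many sets of pairs that vanish at an
  additional edge.\<close>

lemma Omega0_in_coset_algebra:
  assumes "finite (arcs G)" and "X \<subseteq> arcs G" and "Y \<subseteq> arcs G"
  shows "Omega0 G X Y \<in> coset_algebra G"
proof -
  interpret algebra "Omega G" "coset_algebra G"
    by (rule algebra_coset_algebra)
  have "Omega0 G X Y = Omega_on G X Y -
      ((\<Union>e\<in>arcs G - X. Omega_on G {e} {}) \<union> (\<Union>e\<in>arcs G - Y. Omega_on G {} {e}))"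
    using assms by (auto simp: Omega0_def Omega_on_def fker_def fsupp_def)
  also have "\<dots> \<in> coset_algebra G"
    using assms by (intro Diff Un finite_UN Omega_on_in_coset_algebra) auto
  finally show ?thesis .
qed

section \<open>Decomposition into strata\<close>

text \<open>On disjoint sets the intersection term is \<open>\<nu> {} = 0\<close>, so the valuation
  identity becomes additivity. The algebra keeps the partial unions in the domain during the
  induction.\<close>

lemma valuation_on_UN:
  assumes "algebra \<Omega> \<B>" and "valuation_on \<B> \<nu>" and "finite I"
    and "\<And>i. i \<in> I \<Longrightarrow> S i \<in> \<B>" and "disjoint_family_on S I"
  shows "\<nu> (\<Union>i\<in>I. S i) = (\<Sum>i\<in>I. \<nu> (S i))"
  using assms(3-5)
proof (induction I)
  case empty
  then show ?case using assms(2) by (simp add: valuation_on_def)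
next
  case (insert i I)
  interpret algebra \<Omega> \<B> by (rule assms(1))
  have "disjoint_family_on S I" and disj: "S i \<inter> (\<Union>j\<in>I. S j) = {}"
    using insert.prems(2) insert.hyps by (auto simp: disjoint_family_on_def)
  moreover have "(\<Union>j\<in>I. S j) \<in> \<B>"
    using insert.prems insert.hyps by (intro finite_UN) auto
  ultimately show ?case
    using assms(2) insert unfolding valuation_on_def
    by (metis (no_types, lifting) UN_insert add.right_neutral insertCI sum.insert)
qed

text \<open>Every pair lies in exactly one stratum, the one indexed by its own kernels, so the
  strata with \<open>Z \<subseteq> X\<close> and \<open>Y' \<subseteq> Y\<close> partition the
  set.\<close>

lemma valuation_Omega_on:
  fixes \<nu> :: "(('e \<Rightarrow> 'a::ab_group_add) \<times> ('e \<Rightarrow> 'b::ab_group_add)) set \<Rightarrow> 'r::comm_ring_1"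
  assumes "finite (arcs G)" and "valuation_on (coset_algebra G) \<nu>"
    and "Z \<subseteq> arcs G" and "Y' \<subseteq> arcs G"
  shows "\<nu> (Omega_on G Z Y') = (\<Sum>(X, Y)\<in>Pow (arcs G) \<times> Pow (arcs G).
    if Z \<subseteq> X \<and> Y' \<subseteq> Y then \<nu> (Omega0 G X Y) else 0)"
proof -
  let ?I = "{(X, Y). X \<subseteq> arcs G \<and> Y \<subseteq> arcs G \<and> Z \<subseteq> X \<and> Y' \<subseteq> Y}"
  have I: "?I = {p \<in> Pow (arcs G) \<times> Pow (arcs G). Z \<subseteq> fst p \<and> Y' \<subseteq> snd p}"
    by auto
  then have fin: "finite ?I"
    using assms(1) by simp
  have eq: "Omega_on G Z Y' = (\<Union>p\<in>?I. case p of (X, Y) \<Rightarrow> Omega0 G X Y)"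
    using assms(3,4) by (auto simp: Omega_on_def Omega0_def fker_def fsupp_def)
  have disj: "disjoint_family_on (\<lambda>(X, Y). Omega0 G X Y) ?I"
    by (auto simp: disjoint_family_on_def Omega0_def)
  have "(case p of (X, Y) \<Rightarrow> Omega0 G X Y) \<in> coset_algebra G" if "p \<in> ?I" for p
    using that Omega0_in_coset_algebra[OF assms(1)] by auto
  then have "\<nu> (Omega_on G Z Y') = (\<Sum>p\<in>?I. \<nu> (case p of (X, Y) \<Rightarrow> Omega0 G X Y))"
    unfolding eq using disj by (rule valuation_on_UN[OF algebra_coset_algebra assms(2) fin])
  \<comment> \<open>Padding with zeros makes the index set independent of \<open>Z\<close> and
    \<open>Y'\<close>, which prepares the exchange of sums.\<close>
  also have "\<dots> = (\<Sum>(X, Y)\<in>Pow (arcs G) \<times> Pow (arcs G).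
      if Z \<subseteq> X \<and> Y' \<subseteq> Y then \<nu> (Omega0 G X Y) else 0)"
    unfolding I using assms(1) by (subst sum.inter_filter) (auto intro!: sum.cong)
  finally show ?thesis .
qed

section \<open>Kernel integrals and the exchange of summation\<close>

lemma kernel_integral_eq:
  fixes \<nu> :: "(('e \<Rightarrow> 'a::ab_group_add) \<times> ('e \<Rightarrow> 'b::ab_group_add)) set \<Rightarrow> 'r::comm_ring_1"
  assumes "finite (arcs G)"
  shows "kernel_integral G \<nu> P w = (\<Sum>(X, Y)\<in>Pow (arcs G) \<times> Pow (arcs G).
    (if P X Y then w X Y else 0) * \<nu> (Omega0 G X Y))"
proof -
  have I: "{(X, Y). X \<subseteq> arcs G \<and> Y \<subseteq> arcs G \<and> P X Y}
      = {p \<in> Pow (arcs G) \<times> Pow (arcs G). P (fst p) (snd p)}"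
    by auto
  show ?thesis
    unfolding kernel_integral_def I using assms
    by (subst sum.inter_filter) (auto intro!: sum.cong)
qed

lemma kernel_integral_power:
  fixes \<nu> :: "(('e \<Rightarrow> 'a::ab_group_add) \<times> ('e \<Rightarrow> 'b::ab_group_add)) set \<Rightarrow> 'r::comm_ring_1"
  assumes "finite (arcs G)" and "valuation_on (coset_algebra G) \<nu>"
  shows "kernel_integral G \<nu> (\<lambda>X Y. X \<subseteq> arcs G - Y) (\<lambda>X Y. u ^ card X * v ^ card (arcs G - Y))
      = (\<Sum>Z\<in>Pow (arcs G). \<Sum>W\<in>Pow (arcs G).
           (- 1) ^ card Z * h_weight (arcs G) u v Z W * \<nu> (Omega_on G Z (arcs G - W)))"
proof -
  let ?E = "arcs G"
  let ?PE = "Pow ?E \<times> Pow ?E"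
  let ?c = "\<lambda>Z W. (- 1) ^ card Z * h_weight ?E u v Z W"
  let ?i = "\<lambda>Z W X Y. if Z \<subseteq> X \<and> ?E - W \<subseteq> Y then 1 else (0::'r)"
  have "(\<Sum>Z\<in>Pow ?E. \<Sum>W\<in>Pow ?E. ?c Z W * \<nu> (Omega_on G Z (?E - W)))
      = (\<Sum>(Z, W)\<in>?PE. \<Sum>(X, Y)\<in>?PE. ?c Z W * ?i Z W X Y * \<nu> (Omega0 G X Y))"
    unfolding sum.cartesian_product
    by (intro sum.cong refl)
      (auto simp: valuation_Omega_on[OF assms] sum_distrib_left intro!: sum.cong)
  \<comment> \<open>Both pairs range over the same fixed finite set, so the two summations can be
    swapped.\<close>
  also have "\<dots> = (\<Sum>(X, Y)\<in>?PE. \<Sum>(Z, W)\<in>?PE. ?c Z W * ?i Z W X Y * \<nu> (Omega0 G X Y))"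
    unfolding case_prod_beta by (rule sum.swap)
  also have "\<dots> = (\<Sum>(X, Y)\<in>?PE.
      (\<Sum>Z\<in>Pow ?E. \<Sum>W\<in>Pow ?E. ?c Z W * ?i Z W X Y) * \<nu> (Omega0 G X Y))"
    by (simp only: sum_distrib_right sum.cartesian_product case_prod_unfold)
  \<comment> \<open>The inner double sum is now the coefficient of one stratum, evaluated by
    \<open>sum_h_weight\<close>.\<close>
  also have "\<dots> = (\<Sum>(X, Y)\<in>?PE.
      (if X \<subseteq> ?E - Y then u ^ card X * v ^ card (?E - Y) else 0) * \<nu> (Omega0 G X Y))"
  proof (intro sum.cong refl, clarify)
    fix X Y assume "X \<subseteq> ?E" "Y \<subseteq> ?E"
    then show "(\<Sum>Z\<in>Pow ?E. \<Sum>W\<in>Pow ?E. ?c Z W * ?i Z W X Y) * \<nu> (Omega0 G X Y)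
        = (if X \<subseteq> ?E - Y then u ^ card X * v ^ card (?E - Y) else 0) * \<nu> (Omega0 G X Y)"
      by (intro arg_cong2[where f = "(*)"] sum_h_weight[OF assms(1)] refl)
  qed
  also have "\<dots> = kernel_integral G \<nu> (\<lambda>X Y. X \<subseteq> ?E - Y)
      (\<lambda>X Y. u ^ card X * v ^ card (?E - Y))"
    by (rule kernel_integral_eq[OF assms(1), symmetric])
  finally show ?thesis ..
qed

theorem theorem6p5:
  fixes G :: "('v, 'e) pre_digraph"
    and u v :: "'r::comm_ring_1"
    and \<nu> :: "(('e \<Rightarrow> 'a::ab_group_add) \<times> ('e \<Rightarrow> 'b::ab_group_add)) set \<Rightarrow> 'r"
  assumes "fin_digraph G"
    and "valuation_on (coset_algebra G) \<nu>"
  shows "(kernel_integral G \<nu> (\<lambda>X Y. X \<subseteq> arcs G - Y) (\<lambda>X Y. u ^ card X * v ^ card (arcs G - Y))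
      = (\<Sum>Z\<in>Pow (arcs G). \<Sum>W\<in>Pow (arcs G).
           (- 1) ^ card Z * h_weight (arcs G) u v Z W * \<nu> (Omega_on G Z (arcs G - W))))
    \<and> kernel_integral G \<nu> (\<lambda>X Y. X \<subseteq> arcs G - Y) (\<lambda>X Y. 1)
      = (\<Sum>Z\<in>Pow (arcs G). (- 1) ^ card Z * \<nu> (Omega_on G Z Z))"
proof -
  let ?E = "arcs G"
  have fin: "finite ?E"
    using assms(1) by (rule fin_digraph.finite_arcs)
  \<comment> \<open>At \<open>u = v = 1\<close> only \<open>W = ?E - Z\<close> contributes, and then
    \<open>?E - W\<close> is \<open>Z\<close> again.\<close>
  have "(\<Sum>W\<in>Pow ?E. (- 1) ^ card Z * h_weight ?E 1 1 Z W * \<nu> (Omega_on G Z (?E - W)))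
      = (- 1) ^ card Z * \<nu> (Omega_on G Z Z)" if "Z \<in> Pow ?E" for Z
  proof -
    have "(\<Sum>W\<in>Pow ?E. (- 1) ^ card Z * h_weight ?E 1 1 Z W * \<nu> (Omega_on G Z (?E - W)))
        = (\<Sum>W\<in>Pow ?E. if W = ?E - Z then (- 1) ^ card Z * \<nu> (Omega_on G Z (?E - W)) else 0)"
      using that by (intro sum.cong refl) (simp add: h_weight_one_one[OF fin])
    also have "\<dots> = (- 1) ^ card Z * \<nu> (Omega_on G Z (?E - (?E - Z)))"
      using fin by simp
    also have "?E - (?E - Z) = Z"
      using that by auto
    finally show ?thesis .
  qed
  \<comment> \<open>With \<open>u = v = 1\<close> the integrand is a product of powers of 1, so the
    general identity specializes to the unweighted integral.\<close>
  then have "kernel_integral G \<nu> (\<lambda>X Y. X \<subseteq> ?E - Y) (\<lambda>X Y. 1)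
      = (\<Sum>Z\<in>Pow ?E. (- 1) ^ card Z * \<nu> (Omega_on G Z Z))"
    using kernel_integral_power[OF fin assms(2), of 1 1] by simp
  then show ?thesis
    using kernel_integral_power[OF fin assms(2)] by blast
qed

end
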